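(* For an integer $n \geq 3$, let $K_n^{1/2}$ denote the graph obtained from the complete graph $K_n$ by subdividing every edge exactly once. Then $$\frac{1}{2}\left\lfloor \log\log(n-1)\right\rfloor \leq \pi(K_n^{1/2}) \leq (1+o(1))\log\log(n-1),$$ where $o(1)$ denotes a quantity tending to $0$ as $n \to \infty$.
   Context: All graphs are finite, simple and undirected; $\log$ denotes the logarithm to base $2$. Subdividing an edge $\{x,y\}$ once means replacing it by a path $x, w, y$ through a new vertex $w$ of degree $2$. A permutation of a finite set $U$ is a bijection $\sigma: U \to [|U|]$. For disjoint $A,B \subseteq U$, write $A \prec_\sigma B$ if $\sigma(a)<\sigma(b)$ for all $a \in A$, $b \in B$; $\sigma$ separates $A$ and $B$ if $A \prec_\sigma B$ or $B \prec_\sigma A$. A family $\mathcal{F}$ of permutations of $V(G)$ is pairwise suitable for $G$ if for every two disjoint edges $e,f$ of $G$ (viewed as 2-element vertex sets) some $\sigma \in \mathcal{F}$ separates $e$ and $f$. The separation dimension $\pi(G)$ is the minimum cardinality of a family of permutations of $V(G)$ that is pairwise suitable for $G$.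
   Formalization: The upper bound is stated for n ≥ 4 rather than n ≥ 3, because at n = 3 log log(n−1) = 0 while the subdivided triangle is a 6-cycle with separation dimension at least 1, so the bound fails there for any value of o(1). *)

theory Defs
  imports Complex_Main "HOL-Library.FuncSet"
begin

text \<open>A graph is a pair of a vertex set and a set of edges, the edges being 2-element vertex sets.\<close>

type_synonym 'a graph = "'a set \<times> 'a set set"

abbreviation verts :: "'a graph \<Rightarrow> 'a set" where "verts \<equiv> fst"
abbreviation edges :: "'a graph \<Rightarrow> 'a set set" where "edges \<equiv> snd"

definition simple_graph :: "'a graph \<Rightarrow> bool" where
  "simple_graph G \<longleftrightarrow> finite (verts G) \<and> (\<forall>e\<in>edges G. e \<subseteq> verts G \<and> card e = 2)"

definition complete_graph :: "nat \<Rightarrow> nat graph" where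
  "complete_graph n = ({1..n}, {e. e \<subseteq> {1..n} \<and> card e = 2})"

text \<open>Every edge is subdivided exactly once: \<open>Inl v\<close> is the original vertex \<open>v\<close>, and
  \<open>Inr e\<close> is the new vertex of degree 2 placed on the edge \<open>e\<close>.\<close>

definition subdivide :: "'a graph \<Rightarrow> ('a + 'a set) graph" where
  "subdivide G = (Inl ` verts G \<union> Inr ` edges G, {{Inl v, Inr e} | v e. e \<in> edges G \<and> v \<in> e})"

text \<open>Permutations are made extensional so that two of them are equal iff they agree on \<open>U\<close>;
  in particular a finite set has only finitely many permutations.\<close>

definition perms :: "'a set \<Rightarrow> ('a \<Rightarrow> nat) set" where
  "perms U = {\<sigma> \<in> extensional U. bij_betw \<sigma> U {1..card U}}"

definition precedes :: "('a \<Rightarrow> nat) \<Rightarrow> 'a set \<Rightarrow> 'a set \<Rightarrow> bool" where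
  "precedes \<sigma> A B \<longleftrightarrow> (\<forall>a\<in>A. \<forall>b\<in>B. \<sigma> a < \<sigma> b)"

definition separates :: "('a \<Rightarrow> nat) \<Rightarrow> 'a set \<Rightarrow> 'a set \<Rightarrow> bool" where
  "separates \<sigma> A B \<longleftrightarrow> precedes \<sigma> A B \<or> precedes \<sigma> B A"

definition pairwise_suitable :: "('a \<Rightarrow> nat) set \<Rightarrow> 'a graph \<Rightarrow> bool" where
  "pairwise_suitable F G \<longleftrightarrow> F \<subseteq> perms (verts G) \<and>
     (\<forall>e\<in>edges G. \<forall>f\<in>edges G. e \<inter> f = {} \<longrightarrow> (\<exists>\<sigma>\<in>F. separates \<sigma> e f))"

definition separation_dimension :: "'a graph \<Rightarrow> nat" where
  "separation_dimension G = (LEAST k. \<exists>F. finite F \<and> pairwise_suitable F G \<and> card F = k)"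

lemma simple_graph_complete_graph: "simple_graph (complete_graph n)"
  by (auto simp: simple_graph_def complete_graph_def)

lemma simple_graph_subdivide:
  assumes "simple_graph G"
  shows "simple_graph (subdivide G)"
proof -
  have "edges G \<subseteq> Pow (verts G)"
    using assms by (auto simp: simple_graph_def)
  then have "finite (edges G)"
    using assms by (meson simple_graph_def finite_Pow_iff finite_subset)
  then have "finite (verts (subdivide G))"
    using assms by (simp add: simple_graph_def subdivide_def)
  moreover have "e \<subseteq> verts (subdivide G) \<and> card e = 2" if "e \<in> edges (subdivide G)" for e
  proof -
    have "\<exists>v d. e = {Inl v, Inr d} \<and> d \<in> edges G \<and> v \<in> d"
      using that by (simp only: subdivide_def snd_conv mem_Collect_eq)
    then obtain v d where e: "e = {Inl v, Inr d}" and "d \<in> edges G" "v \<in> d"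
      by (elim exE conjE)
    then have "v \<in> verts G"
      using \<open>edges G \<subseteq> Pow (verts G)\<close> by blast
    then show ?thesis
      using \<open>d \<in> edges G\<close> by (simp add: e subdivide_def)
  qed
  ultimately show ?thesis
    by (simp add: simple_graph_def)
qed

lemma finite_perms:
  assumes "finite U"
  shows "finite (perms U)"
proof (rule finite_subset)
  show "perms U \<subseteq> U \<rightarrow>\<^sub>E {1..card U}"
    by (auto simp: perms_def PiE_def bij_betw_def)
  show "finite (U \<rightarrow>\<^sub>E {1..card U})"
    using assms by (intro finite_PiE) auto
qed

lemma ex_perm_precedes:
  assumes U: "finite U" and sub: "A \<subseteq> U" "B \<subseteq> U" and disj: "A \<inter> B = {}"
  shows "\<exists>\<sigma>\<in>perms U. precedes \<sigma> A B"
proof -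
  have fin: "finite A" "finite (U - A)"
    using U sub finite_subset by auto
  have cU: "card U = card A + card (U - A)"
    using card_Diff_subset[OF fin(1) sub(1)] card_mono[OF U sub(1)] by linarith
  have c1: "card A = card {1..card A}" by simp
  have c2: "card (U - A) = card {card A + 1..card U}"
    unfolding cU by simp
  obtain f where f: "bij_betw f A {1..card A}"
    using finite_same_card_bij[OF fin(1) finite_atLeastAtMost c1] by blast
  obtain g where g: "bij_betw g (U - A) {card A + 1..card U}"
    using finite_same_card_bij[OF fin(2) finite_atLeastAtMost c2] by blast
  define s where "s = (\<lambda>x. if x \<in> A then f x else if x \<in> U then g x else undefined)"
  have sA: "bij_betw s A {1..card A}"
    using f by (rule bij_betw_cong[THEN iffD1, rotated]) (simp add: s_def)
  have sB: "bij_betw s (U - A) {card A + 1..card U}"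
    using g by (rule bij_betw_cong[THEN iffD1, rotated]) (auto simp: s_def)
  have "bij_betw s (A \<union> (U - A)) ({1..card A} \<union> {card A + 1..card U})"
    using sA sB by (rule bij_betw_combine) auto
  moreover have "A \<union> (U - A) = U" "{1..card A} \<union> {card A + 1..card U} = {1..card U}"
    using sub cU by auto
  ultimately have "s \<in> perms U"
    using sub by (auto simp: perms_def s_def extensional_def)
  moreover have "s a < s b" if "a \<in> A" "b \<in> B" for a b
  proof -
    have "s a \<le> card A"
      using sA that(1) bij_betwE by fastforce
    moreover have "b \<in> U - A"
      using that sub disj by auto
    then have "card A + 1 \<le> s b"
      using sB bij_betwE by fastforce
    ultimately show ?thesis by simp
  qed
  ultimately show ?thesis
    by (auto simp: precedes_def)
qed

text \<open>The minimum in the definition of the separation dimension is attained.\<close>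

lemma separation_dimension_attained:
  assumes "simple_graph G"
  shows "\<exists>F. finite F \<and> pairwise_suitable F G \<and> card F = separation_dimension G"
  unfolding separation_dimension_def
proof (rule LeastI_ex, intro exI conjI)
  show "finite (perms (verts G))"
    using assms by (simp add: simple_graph_def finite_perms)
  show "pairwise_suitable (perms (verts G)) G"
    unfolding pairwise_suitable_def
  proof (intro conjI subset_refl ballI impI)
    fix e f assume "e \<in> edges G" "f \<in> edges G" and disj: "e \<inter> f = {}"
    then have "finite (verts G)" "e \<subseteq> verts G" "f \<subseteq> verts G"
      using assms by (simp_all add: simple_graph_def)
    from ex_perm_precedes[OF this disj]
    show "\<exists>\<sigma>\<in>perms (verts G). separates \<sigma> e f"
      unfolding separates_def by (elim bexE) (rule bexI, rule disjI1)
  qed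
qed (rule refl)

end

theory Submission
  imports Defs "HOL-Library.Product_Lexorder" "HOL-Real_Asymp.Real_Asymp"
begin

text \<open>
  Lower bound: by Erdos and Szekeres, among more than \<open>r ^ 2 ^ k\<close> original vertices there are more
  than \<open>r\<close> on which all \<open>k\<close> permutations are monotone. Reversing a permutation does not affect
  separation, so all of them may be taken increasing there. Group these vertices into consecutive
  pairs \<open>x i < y i\<close> and colour \<open>(i, j)\<close> by the set of permutations that put the subdivision
  vertex of \<open>{x i, y j}\<close> above \<open>x j\<close>. A permutation separating the half-edges
  at \<open>y j\<close> (towards \<open>x i\<close>) and at \<open>x j\<close> (towards \<open>y l\<close>) is in the colour of \<open>(i, j)\<close> but not
  in that of \<open>(j, l)\<close>, so this properly colours the shift graph with \<open>2 ^ k\<close> colours.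

  Upper bound: the permutations keep the original vertices in their natural order and place each
  subdivision vertex next to the lower or the upper end of its edge. The difficult half-edges are
  those at \<open>a\<close> towards \<open>b\<close> and at \<open>c\<close> towards \<open>d\<close> with \<open>d < a < c < b\<close>; they need the lower end
  for \<open>{a, b}\<close> and the upper end for \<open>{d, c}\<close>. The choice is made according to the level at which
  the two ends of the edge split in the binary tree, the about \<open>log n\<close> levels being encoded
  by an antichain of \<open>s\<close>-subsets of a \<open>2 s\<close>-set with \<open>2 s\<close> close to \<open>log log n\<close>. When both edges
  split at the same level, they split at the same tree node, and one more
  permutation, with subdivision vertices placed at the split point, separates them.
\<close>

section \<open>Monotone subsets and shift graphs\<close>

definition is_chain :: "('a::linorder \<Rightarrow> 'a \<Rightarrow> bool) \<Rightarrow> 'a set \<Rightarrow> bool" where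
  "is_chain P T \<longleftrightarrow> (\<forall>a\<in>T. \<forall>b\<in>T. a < b \<longrightarrow> P a b)"

definition chains_to :: "'a::linorder set \<Rightarrow> ('a \<Rightarrow> 'a \<Rightarrow> bool) \<Rightarrow> 'a \<Rightarrow> 'a set set" where
  "chains_to S P x = {T. T \<subseteq> S \<and> x \<in> T \<and> (\<forall>t\<in>T. t \<le> x) \<and> is_chain P T}"

text \<open>The length of a longest chain ending at \<open>x\<close>, as in Seidenberg's proof of
  the Erdos-Szekeres theorem.\<close>

definition chain_rank :: "'a::linorder set \<Rightarrow> ('a \<Rightarrow> 'a \<Rightarrow> bool) \<Rightarrow> 'a \<Rightarrow> nat" where
  "chain_rank S P x = Max (card ` chains_to S P x)"

lemma finite_chains_to: "finite S \<Longrightarrow> finite (chains_to S P x)"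
  by (rule finite_subset[of _ "Pow S"]) (auto simp: chains_to_def)

lemma singleton_in_chains_to: "x \<in> S \<Longrightarrow> {x} \<in> chains_to S P x"
  by (simp add: chains_to_def is_chain_def)

lemma card_le_chain_rank:
  assumes "finite S" "T \<in> chains_to S P x"
  shows "card T \<le> chain_rank S P x"
  unfolding chain_rank_def using assms by (intro Max_ge) (auto simp: finite_chains_to)

lemma chain_rank_attained:
  assumes "finite S" "x \<in> S"
  obtains T where "T \<in> chains_to S P x" "card T = chain_rank S P x"
proof -
  have "chain_rank S P x \<in> card ` chains_to S P x"
    unfolding chain_rank_def
    using assms singleton_in_chains_to by (intro Max_in) (auto simp: finite_chains_to)
  then show thesis using that by auto
qed

text \<open>A longest chain ending at \<open>x\<close> can be prolonged by \<open>y\<close>;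
  transitivity makes \<open>y\<close> compatible with its earlier members.\<close>

lemma chain_rank_less:
  assumes "finite S" "transp P" "x \<in> S" "y \<in> S" "x < y" "P x y"
  shows "chain_rank S P x < chain_rank S P y"
proof -
  obtain T where T: "T \<in> chains_to S P x" "card T = chain_rank S P x"
    by (rule chain_rank_attained[OF assms(1,3)])
  then have *: "T \<subseteq> S" "x \<in> T" "is_chain P T" "finite T"
    using assms(1) by (auto simp: chains_to_def intro: finite_subset)
  have t: "t < y" if "t \<in> T" for t
    using T that \<open>x < y\<close> by (auto simp: chains_to_def)
  have "P t y" if "t \<in> T" for t
  proof (cases "t = x")
    case False
    with that T(1) have "P t x" by (auto simp: chains_to_def is_chain_def)
    then show ?thesis using \<open>P x y\<close> \<open>transp P\<close> by (meson transpD)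
  qed (use assms in simp)
  then have "is_chain P (insert y T)"
    using *(3) t by (auto simp: is_chain_def dest: less_asym)
  then have "insert y T \<in> chains_to S P y"
    using * t assms(4) by (auto simp: chains_to_def less_imp_le)
  then have "card (insert y T) \<le> chain_rank S P y"
    by (rule card_le_chain_rank[OF assms(1)])
  moreover have "y \<notin> T" using t by blast
  ultimately show ?thesis
    using T(2) *(4) by simp
qed

text \<open>The pair of ranks is injective, since one coordinate grows whenever
  \<open>a < b\<close>; without a chain longer than \<open>r\<close> it has at most
  \<open>r * r\<close> values.\<close>

lemma erdos_szekeres:
  fixes S :: "'a::linorder set"
  assumes "finite S" "transp P" "transp Q"
    and PQ: "\<And>a b. a \<in> S \<Longrightarrow> b \<in> S \<Longrightarrow> a < b \<Longrightarrow> P a b \<or> Q a b"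
    and card: "card S > r * r"
  shows "\<exists>T\<subseteq>S. card T > r \<and> (is_chain P T \<or> is_chain Q T)"
proof (rule ccontr)
  assume no: "\<not> ?thesis"
  let ?f = "\<lambda>x. (chain_rank S P x, chain_rank S Q x)"
  have bound: "chain_rank S R x \<in> {1..r}" if x: "x \<in> S" and R: "R = P \<or> R = Q" for R x
  proof -
    obtain T where T: "T \<in> chains_to S R x" "card T = chain_rank S R x"
      by (rule chain_rank_attained[OF assms(1) x])
    then have "T \<subseteq> S" "is_chain R T"
      by (simp_all add: chains_to_def)
    then have "card T \<le> r"
      using no R by (metis not_le)
    moreover have "1 \<le> chain_rank S R x"
      using card_le_chain_rank[OF assms(1) singleton_in_chains_to[OF x]] by simp
    ultimately show ?thesis using T by simp
  qed
  have "inj_on ?f S"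
  proof (rule linorder_inj_onI')
    fix x y assume "x \<in> S" "y \<in> S" "x < y"
    then show "?f x \<noteq> ?f y"
      using PQ[of x y] chain_rank_less[OF assms(1)] assms(2,3) by fastforce
  qed
  moreover have "?f ` S \<subseteq> {1..r} \<times> {1..r}"
    using bound by auto
  ultimately have "card S \<le> card ({1..r} \<times> {1..r})"
    by (intro card_inj_on_le) auto
  then show False using card by simp
qed

text \<open>Each function costs one application of \<open>erdos_szekeres\<close>, which takes a
  square root of the size.\<close>

lemma simultaneously_monotone_subset:
  fixes S :: "'a::linorder set" and F :: "('a \<Rightarrow> 'b::linorder) set"
  assumes "finite F" "finite S" "\<And>f. f \<in> F \<Longrightarrow> inj_on f S" "card S > r ^ (2 ^ card F)"
  obtains T where "T \<subseteq> S" "card T > r"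
    "\<And>f. f \<in> F \<Longrightarrow> monotone_on T (<) (<) f \<or> monotone_on T (<) (>) f"
  using assms
proof (induction F arbitrary: S thesis rule: finite_induct)
  case empty
  show ?case by (rule empty.prems(1)[of S]) (use empty.prems in auto)
next
  case (insert f F)
  let ?r = "r ^ (2 ^ card F)"
  have "card S > ?r * ?r"
    using insert by (simp flip: power_add mult_2)
  moreover have "f a < f b \<or> f b < f a" if "a \<in> S" "b \<in> S" "a < b" for a b
    using insert.prems(3)[of f] that by (metis inj_onD insertI1 less_irrefl neqE)
  ultimately obtain S' where S': "S' \<subseteq> S" "card S' > ?r"
    "is_chain (\<lambda>a b. f a < f b) S' \<or> is_chain (\<lambda>a b. f a > f b) S'"
    using erdos_szekeres[OF insert.prems(2), of "\<lambda>a b. f a < f b" "\<lambda>a b. f a > f b" ?r]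
    by (simp add: transp_def) (metis order.strict_trans)
  have "finite S'" using S' insert.prems finite_subset by blast
  moreover have "inj_on g S'" if "g \<in> F" for g
    using insert.prems(3) that S'(1) by (meson inj_on_subset insertI2)
  ultimately obtain T where T: "T \<subseteq> S'" "card T > r"
    "\<And>g. g \<in> F \<Longrightarrow> monotone_on T (<) (<) g \<or> monotone_on T (<) (>) g"
    using insert.IH S'(2) by blast
  have "monotone_on T (<) (<) f \<or> monotone_on T (<) (>) f"
    using S'(3) T(1) by (auto simp: monotone_on_def is_chain_def subset_iff)
  then show ?case using T S'(1) insert.prems(1)[of T] by blast
qed

text \<open>The set of colours entering \<open>j\<close> determines \<open>j\<close>.\<close>

lemma shift_graph_colouring:
  fixes c :: "nat \<Rightarrow> nat \<Rightarrow> 'c"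
  assumes "finite C" "\<And>i j. i < j \<Longrightarrow> j < m \<Longrightarrow> c i j \<in> C"
    and "\<And>i j l. i < j \<Longrightarrow> j < l \<Longrightarrow> l < m \<Longrightarrow> c i j \<noteq> c j l"
  shows "m \<le> 2 ^ card C"
proof -
  let ?\<Phi> = "\<lambda>j. (\<lambda>i. c i j) ` {..<j}"
  have "inj_on ?\<Phi> {..<m}"
  proof (rule linorder_inj_onI')
    fix j l assume jl: "j \<in> {..<m}" "l \<in> {..<m}" "j < l"
    then have "c j l \<in> ?\<Phi> l" "c j l \<notin> ?\<Phi> j"
      using assms(3) by (auto, metis)
    then show "?\<Phi> j \<noteq> ?\<Phi> l" by blast
  qed
  moreover have "?\<Phi> ` {..<m} \<subseteq> Pow C"
    using assms(2) by auto
  ultimately have "card {..<m} \<le> card (Pow C)"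
    using assms(1) by (intro card_inj_on_le) auto
  then show ?thesis using assms(1) by (simp add: card_Pow)
qed

section \<open>The lower bound\<close>

lemma edge_subdivide_complete_graph:
  "e \<in> edges (subdivide (complete_graph n)) \<longleftrightarrow>
     (\<exists>a b. a \<in> {1..n} \<and> b \<in> {1..n} \<and> a \<noteq> b \<and> e = {Inl a, Inr {a, b}})"
proof
  assume "e \<in> edges (subdivide (complete_graph n))"
  then obtain v d where *: "e = {Inl v, Inr d}" "d \<subseteq> {1..n}" "card d = 2" "v \<in> d"
    by (auto simp: subdivide_def complete_graph_def)
  then obtain b where "d = {v, b}" "v \<noteq> b"
    by (auto simp: card_2_iff doubleton_eq_iff)
  then show "\<exists>a b. a \<in> {1..n} \<and> b \<in> {1..n} \<and> a \<noteq> b \<and> e = {Inl a, Inr {a, b}}"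
    using * by auto
next
  assume "\<exists>a b. a \<in> {1..n} \<and> b \<in> {1..n} \<and> a \<noteq> b \<and> e = {Inl a, Inr {a, b}}"
  then obtain a b where "a \<in> {1..n}" "b \<in> {1..n}" "a \<noteq> b" "e = {Inl a, Inr {a, b}}" by blast
  then show "e \<in> edges (subdivide (complete_graph n))"
    by (auto simp: subdivide_def complete_graph_def intro!: exI[of _ a] exI[of _ "{a, b}"])
qed

text \<open>Values in an arbitrary linear order let reversed permutations enter as negated
  integers.\<close>

lemma card_le_if_monotone_separating:
  fixes G :: "(nat + nat set \<Rightarrow> 'b::linorder) set"
  assumes "finite G" and T: "finite T"
    and mono: "\<And>g a b. g \<in> G \<Longrightarrow> a \<in> T \<Longrightarrow> b \<in> T \<Longrightarrow> a < b \<Longrightarrow> g (Inl a) < g (Inl b)"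
    and sep: "\<And>a b c d. \<lbrakk>a \<in> T; b \<in> T; c \<in> T; d \<in> T; a \<noteq> b; c \<noteq> d; a \<noteq> c; {a, b} \<noteq> {c, d}\<rbrakk> \<Longrightarrow>
        \<exists>g\<in>G. (\<forall>u\<in>{Inl a, Inr {a, b}}. \<forall>v\<in>{Inl c, Inr {c, d}}. g u < g v) \<or>
              (\<forall>u\<in>{Inl a, Inr {a, b}}. \<forall>v\<in>{Inl c, Inr {c, d}}. g v < g u)"
    and m: "2 * m \<le> card T"
  shows "m \<le> 2 ^ 2 ^ card G"
proof -
  let ?xs = "sorted_list_of_set T"
  define x y where "x = (\<lambda>i. ?xs ! (2 * i))" and "y = (\<lambda>i. ?xs ! (2 * i + 1))"
  have inT: "x i \<in> T" "y i \<in> T" if "i < m" for i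
    using that m T nth_mem[of "2 * i" ?xs] nth_mem[of "2 * i + 1" ?xs] by (auto simp: x_def y_def)
  have nth_less: "?xs ! i < ?xs ! j" if "i < j" "j < 2 * m" for i j
    using that m by (intro sorted_wrt_nth_less[OF strict_sorted_list_of_set]) auto
  have xy: "x i < y i" if "i < m" for i
    using that nth_less by (simp add: x_def y_def)
  have yx: "y i < x j" if "i < j" "j < m" for i j
    using that nth_less by (simp add: x_def y_def)
  define E where "E = (\<lambda>i j. {g \<in> G. g (Inr {x i, y j}) > g (Inl (x j))})"
  have "m \<le> 2 ^ card (Pow G)"
  proof (rule shift_graph_colouring)
    fix i j l assume ijl: "i < j" "j < l" "l < m"
    note less = xy[of i] xy[of j] xy[of l] yx[of i j] yx[of j l]
    have ne: "y j \<noteq> x i" "x j \<noteq> y l" "y j \<noteq> x j" "{y j, x i} \<noteq> {x j, y l}"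
      using less ijl by (auto simp: doubleton_eq_iff)
    obtain g where g: "g \<in> G"
      and or: "(\<forall>u\<in>{Inl (y j), Inr {y j, x i}}. \<forall>v\<in>{Inl (x j), Inr {x j, y l}}. g u < g v) \<or>
               (\<forall>u\<in>{Inl (y j), Inr {y j, x i}}. \<forall>v\<in>{Inl (x j), Inr {x j, y l}}. g v < g u)"
      using sep[of "y j" "x i" "x j" "y l"] ne inT ijl by auto
    have "g (Inl (x j)) < g (Inl (y j))"
      using mono[OF g, of "x j" "y j"] less inT ijl by auto
    \<comment> \<open>Since \<open>x j\<close> lies below \<open>y j\<close>, only the second
      disjunct of the separation can hold.\<close>
    with or have "g (Inl (x j)) < g (Inr {x i, y j})" "g (Inr {x j, y l}) < g (Inl (y j))"
      by (auto simp: insert_commute)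
    moreover have "g (Inl (y j)) < g (Inl (x l))"
      using mono[OF g, of "y j" "x l"] less inT ijl by auto
    ultimately have "g \<in> E i j" "g \<notin> E j l"
      using g by (auto simp: E_def)
    then show "E i j \<noteq> E j l" by blast
  qed (use \<open>finite G\<close> in \<open>auto simp: E_def\<close>)
  then show ?thesis using \<open>finite G\<close> by (simp add: card_Pow)
qed

text \<open>With \<open>k\<close> permutations, \<open>r ^ 2 ^ k = 2 ^ 2 ^ (2 * k + 1)\<close>. A
  larger \<open>n\<close> would give \<open>2 ^ (2 ^ (k + 1) - 1)\<close> pairs, half of
  \<open>r\<close>, and force \<open>2 ^ (k + 1) - 1 \<le> 2 ^ k\<close>, which fails for
  \<open>k > 0\<close>.\<close>

lemma pairwise_suitable_lower_bound:
  assumes n: "n \<ge> 3" and fin: "finite F"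
    and F: "pairwise_suitable F (subdivide (complete_graph n))"
  shows "n \<le> 2 ^ 2 ^ (2 * card F + 1)"
proof (rule ccontr)
  assume big: "\<not> ?thesis"
  let ?V = "verts (subdivide (complete_graph n))"
  define r k where "r = (2::nat) ^ 2 ^ (card F + 1)" and "k = card F"
  have V: "Inl a \<in> ?V" if "a \<in> {1..n}" for a
    using that by (auto simp: subdivide_def complete_graph_def)
  have sep: "\<exists>\<sigma>\<in>F. separates \<sigma> {Inl a, Inr {a, b}} {Inl c, Inr {c, d}}"
    if "{a, b, c, d} \<subseteq> {1..n}" "a \<noteq> b" "c \<noteq> d" "a \<noteq> c" "{a, b} \<noteq> {c, d}" for a b c d
  proof -
    have "{Inl a, Inr {a, b}} \<in> edges (subdivide (complete_graph n))"
      "{Inl c, Inr {c, d}} \<in> edges (subdivide (complete_graph n))"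
      using that by (auto simp: edge_subdivide_complete_graph)
    moreover have "{Inl a, Inr {a, b}} \<inter> {Inl c, Inr {c, d}} = {}"
      using that by auto
    ultimately show ?thesis
      using F unfolding pairwise_suitable_def by blast
  qed
  \<comment> \<open>The half-edges at 1 towards 2 and at 2 towards 3 are disjoint, so
    \<open>F\<close> is nonempty.\<close>
  have "k > 0"
    using sep[of 1 2 2 3] n fin by (auto simp: k_def doubleton_eq_iff card_gt_0_iff)
  have inj: "inj_on (\<lambda>v. \<sigma> (Inl v)) {1..n}" if "\<sigma> \<in> F" for \<sigma>
  proof -
    have "inj_on \<sigma> ?V"
      using F that by (auto simp: pairwise_suitable_def perms_def bij_betw_def)
    then show ?thesis by (intro inj_onI) (metis V inj_onD sum.inject(1))
  qed
  let ?F = "(\<lambda>\<sigma> v. \<sigma> (Inl v)) ` F"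
  \<comment> \<open>Permutations may coincide on the original vertices, so \<open>?F\<close> can be
    smaller than \<open>F\<close>.\<close>
  have "r ^ (2 ^ card ?F) \<le> r ^ (2 ^ card F)"
    using fin card_image_le by (intro power_increasing) (auto simp: r_def)
  also have "\<dots> = 2 ^ 2 ^ (2 * card F + 1)"
  proof -
    have "(2::nat) ^ (2 * card F + 1) = 2 ^ (card F + 1) * 2 ^ card F"
      by (simp only: mult_2 add.assoc add.commute add.left_commute flip: power_add)
    then show ?thesis by (simp only: r_def power_mult)
  qed
  also have "\<dots> < card {1..n}" using big by simp
  finally have "card {1..n} > r ^ (2 ^ card ?F)" .
  moreover have "inj_on f {1..n}" if "f \<in> ?F" for f
    using that inj by blast
  moreover have "finite ?F" using fin by simp
  ultimately obtain T where T: "T \<subseteq> {1..n}" "card T > r" and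
    mono: "\<And>f. f \<in> ?F \<Longrightarrow> monotone_on T (<) (<) f \<or> monotone_on T (<) (>) f"
    using simultaneously_monotone_subset[of ?F "{1..n}" r] by (metis finite_atLeastAtMost)
  define orient :: "(nat + nat set \<Rightarrow> nat) \<Rightarrow> nat + nat set \<Rightarrow> int" where
    "orient = (\<lambda>\<sigma> u. if monotone_on T (<) (<) (\<lambda>v. \<sigma> (Inl v)) then int (\<sigma> u) else - int (\<sigma> u))"
  have "2 ^ (2 ^ (k + 1) - 1) \<le> (2::nat) ^ 2 ^ card (orient ` F)"
  proof (rule card_le_if_monotone_separating)
    show "finite (orient ` F)" "finite T"
      using fin T finite_subset by auto
    show "g (Inl a) < g (Inl b)" if "g \<in> orient ` F" "a \<in> T" "b \<in> T" "a < b" for g a b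
      using that mono by (fastforce simp: orient_def monotone_on_def)
    show "\<exists>g\<in>orient ` F. (\<forall>u\<in>{Inl a, Inr {a, b}}. \<forall>v\<in>{Inl c, Inr {c, d}}. g u < g v) \<or>
              (\<forall>u\<in>{Inl a, Inr {a, b}}. \<forall>v\<in>{Inl c, Inr {c, d}}. g v < g u)"
      if abcd: "a \<in> T" "b \<in> T" "c \<in> T" "d \<in> T" "a \<noteq> b" "c \<noteq> d" "a \<noteq> c" "{a, b} \<noteq> {c, d}" for a b c d
    proof -
      obtain \<sigma> where "\<sigma> \<in> F" "separates \<sigma> {Inl a, Inr {a, b}} {Inl c, Inr {c, d}}"
        using sep[OF _ abcd(5-8)] abcd(1-4) T(1) by (metis empty_subsetI insert_subset subsetD)
      then show ?thesis
        by (intro bexI[of _ "orient \<sigma>"]) (auto simp: separates_def precedes_def orient_def)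
    qed
    have "2 * 2 ^ (2 ^ (k + 1) - 1) = (2::nat) ^ Suc (2 ^ (k + 1) - 1)"
      by (simp only: power_Suc)
    also have "Suc (2 ^ (k + 1) - 1) = 2 ^ (k + 1)"
      by (rule Suc_diff_1) simp
    finally show "2 * 2 ^ (2 ^ (k + 1) - 1) \<le> card T"
      using T by (simp add: r_def k_def)
  qed
  also have "\<dots> \<le> 2 ^ 2 ^ k"
    using fin card_image_le by (intro power_increasing) (auto simp: k_def)
  finally have "2 ^ (k + 1) - 1 \<le> (2::nat) ^ k"
    by simp
  moreover have "(2::nat) ^ 1 \<le> 2 ^ k"
    using \<open>k > 0\<close> by (intro power_increasing) auto
  ultimately show False by simp
qed

lemma separation_dimension_lower_bound:
  assumes "n \<ge> 3"
  shows "1 / 2 * real_of_int \<lfloor>log 2 (log 2 (real n - 1))\<rfloor>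
           \<le> real (separation_dimension (subdivide (complete_graph n)))"
proof -
  obtain F where F: "finite F" "pairwise_suitable F (subdivide (complete_graph n))"
    "card F = separation_dimension (subdivide (complete_graph n))"
    using separation_dimension_attained simple_graph_subdivide simple_graph_complete_graph by blast
  define k where "k = 2 * card F + 1"
  \<comment> \<open>Passing to \<open>n - 1\<close> makes the bound strict, so the floor is at most
    \<open>2 * card F\<close> despite the extra 1 in the exponent.\<close>
  have "n - 1 < 2 ^ 2 ^ k"
    using pairwise_suitable_lower_bound[OF assms F(1,2)] assms by (simp add: k_def)
  then have "real n - 1 < 2 ^ 2 ^ k"
    using assms of_nat_less_iff[of "n - 1" "2 ^ 2 ^ k", where 'a = real] by (simp add: of_nat_diff)
  then have "log 2 (real n - 1) < real (2 ^ k)"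
    using assms by (subst log_less_iff) (auto simp only: powr_realpow)
  then have "log 2 (log 2 (real n - 1)) < real k"
    using assms by (subst log_less_iff) (auto simp: powr_realpow)
  then have "\<lfloor>log 2 (log 2 (real n - 1))\<rfloor> < int k"
    by (simp add: floor_less_iff)
  then show ?thesis using F(3) by (simp add: k_def)
qed

section \<open>The upper bound\<close>

lemma ex_perm_of_key:
  fixes f :: "'a \<Rightarrow> 'k::linorder"
  assumes "finite U"
  shows "\<exists>\<sigma>\<in>perms U. \<forall>u\<in>U. \<forall>v\<in>U. f u < f v \<longrightarrow> \<sigma> u < \<sigma> v"
  using assms
proof (induction U rule: finite_ranking_induct[where f = f])
  case empty
  then show ?case by (auto simp: perms_def bij_betw_def)
next
  case (insert x U)
  show ?case
  proof (cases "x \<in> U")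
    case True
    then show ?thesis using insert by (simp add: insert_absorb)
  next
    case False
    obtain \<sigma> where \<sigma>: "\<sigma> \<in> perms U" "\<And>u v. u \<in> U \<Longrightarrow> v \<in> U \<Longrightarrow> f u < f v \<Longrightarrow> \<sigma> u < \<sigma> v"
      using insert by blast
    \<comment> \<open>The induction inserts elements in nondecreasing order of \<open>f\<close>, so
      \<open>x\<close> can take the last position.\<close>
    let ?\<tau> = "\<sigma>(x := Suc (card U))"
    have "bij_betw \<sigma> U {1..card U}"
      using \<sigma>(1) by (simp add: perms_def)
    then have bij: "bij_betw ?\<tau> U {1..card U}"
      by (rule bij_betw_cong[THEN iffD1, rotated]) (use False in auto)
    then have "bij_betw ?\<tau> (U \<union> {x}) ({1..card U} \<union> {?\<tau> x})"
      using False by (intro notIn_Un_bij_betw) auto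
    moreover have "{1..card U} \<union> {?\<tau> x} = {1..card (insert x U)}"
      using insert(1) False by auto
    ultimately have "bij_betw ?\<tau> (insert x U) {1..card (insert x U)}"
      by simp
    moreover have "?\<tau> \<in> extensional (insert x U)"
      using \<sigma>(1) by (auto simp: perms_def extensional_def)
    ultimately have "?\<tau> \<in> perms (insert x U)"
      by (simp add: perms_def)
    moreover have "?\<tau> u < ?\<tau> v" if uv: "u \<in> insert x U" "v \<in> insert x U" "f u < f v" for u v
    proof -
      have "u \<in> U" "u \<noteq> x" using uv insert(2) False by (auto simp: not_less[symmetric])
      moreover have "?\<tau> u \<le> card U"
        using bij_betwE[OF bij] \<open>u \<in> U\<close> by auto
      ultimately show ?thesis using uv \<sigma>(2) by (cases "v = x") auto
    qed
    ultimately show ?thesis by blast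
  qed
qed

text \<open>Lets keys with ties stand in for permutations: only their strict inequalities must
  survive.\<close>

lemma separation_dimension_le_card_keys:
  fixes K :: "('a \<Rightarrow> 'k::linorder) set"
  assumes "simple_graph G" "finite K"
    and sep: "\<And>e f. \<lbrakk>e \<in> edges G; f \<in> edges G; e \<inter> f = {}\<rbrakk> \<Longrightarrow>
        \<exists>\<kappa>\<in>K. (\<forall>u\<in>e. \<forall>v\<in>f. \<kappa> u < \<kappa> v) \<or> (\<forall>u\<in>e. \<forall>v\<in>f. \<kappa> v < \<kappa> u)"
  shows "separation_dimension G \<le> card K"
proof -
  have fin: "finite (verts G)" using assms(1) by (simp add: simple_graph_def)
  define \<sigma> where "\<sigma> = (\<lambda>\<kappa> :: 'a \<Rightarrow> 'k. SOME \<sigma>. \<sigma> \<in> perms (verts G) \<and>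
      (\<forall>u\<in>verts G. \<forall>v\<in>verts G. \<kappa> u < \<kappa> v \<longrightarrow> \<sigma> u < \<sigma> v))"
  have "\<sigma> \<kappa> \<in> perms (verts G) \<and>
      (\<forall>u\<in>verts G. \<forall>v\<in>verts G. \<kappa> u < \<kappa> v \<longrightarrow> \<sigma> \<kappa> u < \<sigma> \<kappa> v)" for \<kappa>
    unfolding \<sigma>_def by (rule someI_ex[OF ex_perm_of_key[OF fin, of \<kappa>, unfolded Bex_def]])
  then have \<sigma>: "\<And>\<kappa>. \<sigma> \<kappa> \<in> perms (verts G)"
    "\<And>\<kappa> u v. u \<in> verts G \<Longrightarrow> v \<in> verts G \<Longrightarrow> \<kappa> u < \<kappa> v \<Longrightarrow> \<sigma> \<kappa> u < \<sigma> \<kappa> v"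
    by simp_all
  have "pairwise_suitable (\<sigma> ` K) G"
    unfolding pairwise_suitable_def
  proof (intro conjI ballI impI)
    fix e f assume ef: "e \<in> edges G" "f \<in> edges G" "e \<inter> f = {}"
    then have sub: "e \<subseteq> verts G" "f \<subseteq> verts G"
      using assms(1) by (auto simp: simple_graph_def)
    obtain \<kappa> where \<kappa>: "\<kappa> \<in> K"
      "(\<forall>u\<in>e. \<forall>v\<in>f. \<kappa> u < \<kappa> v) \<or> (\<forall>u\<in>e. \<forall>v\<in>f. \<kappa> v < \<kappa> u)"
      using sep[OF ef] by blast
    then have "separates (\<sigma> \<kappa>) e f"
      unfolding separates_def precedes_def using sub by (auto intro!: \<sigma>(2))
    then show "\<exists>\<tau>\<in>\<sigma> ` K. separates \<tau> e f" using \<kappa>(1) by blast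
  qed (use \<sigma> in auto)
  then have "separation_dimension G \<le> card (\<sigma> ` K)"
    unfolding separation_dimension_def using assms(2) by (intro Least_le) blast
  also have "\<dots> \<le> card K" using assms(2) by (rule card_image_le)
  finally show ?thesis .
qed

section \<open>Splits in the binary tree\<close>

text \<open>The split level is the index of the highest binary digit in which \<open>x\<close> and \<open>y\<close> differ; the pivot
  is the start of the upper half of the smallest dyadic interval containing both.\<close>

definition split_level :: "nat \<Rightarrow> nat \<Rightarrow> nat" where
  "split_level x y = (LEAST j. x div 2 ^ Suc j = y div 2 ^ Suc j)"

definition pivot :: "nat \<Rightarrow> nat \<Rightarrow> nat" where
  "pivot x y = y div 2 ^ split_level x y * 2 ^ split_level x y"

text \<open>The quotients agree one level up but, by minimality, differ at the split level, so they
  are the two children of one tree node.\<close>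

lemma split_level:
  assumes "x < y" "y < 2 ^ q"
  shows "split_level x y < q"
    and "\<exists>k. x div 2 ^ split_level x y = 2 * k \<and> y div 2 ^ split_level x y = Suc (2 * k)"
proof -
  let ?P = "\<lambda>j. x div 2 ^ Suc j = y div 2 ^ Suc j" and ?j = "split_level x y"
  obtain p where q: "q = Suc p" using assms by (cases q) auto
  then have p: "?P p" using assms by simp
  show "?j < q"
    unfolding split_level_def q less_Suc_eq_le using p by (rule Least_le)
  have "?P ?j"
    unfolding split_level_def using p by (rule LeastI)
  then have half: "x div 2 ^ ?j div 2 = y div 2 ^ ?j div 2"
    by (simp only: power_Suc2 div_mult2_eq)
  have ne: "x div 2 ^ ?j \<noteq> y div 2 ^ ?j"
  proof (cases ?j)
    case 0
    then show ?thesis using assms by simp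
  next
    case (Suc i)
    then have "\<not> ?P i"
      unfolding split_level_def by (intro not_less_Least) simp
    then show ?thesis using Suc by simp
  qed
  have "x div 2 ^ ?j \<le> y div 2 ^ ?j"
    using assms by (intro div_le_mono) simp
  moreover have "\<exists>k. u = 2 * k \<and> v = Suc (2 * k)"
    if "u div 2 = v div 2" "u \<noteq> v" "u \<le> v" for u v :: nat
    using that by presburger
  ultimately show "\<exists>k. x div 2 ^ ?j = 2 * k \<and> y div 2 ^ ?j = Suc (2 * k)"
    using half ne by blast
qed

lemma pivot_bounds:
  assumes "x < y"
  shows "x < pivot x y" "pivot x y \<le> y"
proof -
  have "x div 2 ^ split_level x y < y div 2 ^ split_level x y"
    using split_level(2)[OF assms less_exp] by auto
  then show "x < pivot x y"
    by (simp add: pivot_def div_less_iff_less_mult)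
qed (simp add: pivot_def)

text \<open>At the common level, \<open>d < a < c\<close> gives
  \<open>2 * k \<le> 2 * l \<le> 2 * k + 1\<close>, so both pairs split at the same node.\<close>

lemma pivot_eq_if_crossing:
  assumes "d < a" "a < c" "c < b" and eq: "split_level d c = split_level a b"
  shows "pivot d c = pivot a b"
proof -
  let ?j = "split_level a b"
  obtain k where k: "d div 2 ^ ?j = 2 * k" "c div 2 ^ ?j = Suc (2 * k)"
    using split_level(2)[of d c, OF _ less_exp] assms by auto
  obtain l where l: "a div 2 ^ ?j = 2 * l" "b div 2 ^ ?j = Suc (2 * l)"
    using split_level(2)[of a b, OF _ less_exp] assms by auto
  have "d div 2 ^ ?j \<le> a div 2 ^ ?j" "a div 2 ^ ?j \<le> c div 2 ^ ?j"
    using assms by (auto intro: div_le_mono)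
  then have "k = l" using k l by linarith
  then show ?thesis using k l eq by (simp add: pivot_def)
qed

section \<open>Antichain codes and sort keys\<close>

lemma ex_antichain:
  assumes "q \<le> (2 * s) choose s"
  shows "\<exists>A. \<forall>i<q. \<forall>j<q. i \<noteq> j \<longrightarrow> (\<exists>t<2 * s. t \<in> A i \<and> t \<notin> A j)"
proof -
  let ?B = "{B. B \<subseteq> {..<2 * s} \<and> card B = s}"
  have "card ?B = (2 * s) choose s"
    using n_subsets[of "{..<2 * s}" s] by simp
  moreover have "finite ?B" by (rule finite_subset[of _ "Pow {..<2 * s}"]) auto
  ultimately obtain A where A: "A ` {..<q} \<subseteq> ?B" "inj_on A {..<q}"
    using card_le_inj[of "{..<q}" ?B] assms by auto
  have "\<exists>t<2 * s. t \<in> A i \<and> t \<notin> A j" if "i < q" "j < q" "i \<noteq> j" for i j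
  proof -
    have *: "A i \<subseteq> {..<2 * s}" "A j \<subseteq> {..<2 * s}" "card (A i) = card (A j)" "A i \<noteq> A j"
      using A that by (auto simp: inj_on_def)
    \<comment> \<open>Distinct finite sets of equal size are never nested.\<close>
    then have "\<not> A i \<subseteq> A j"
      using card_subset_eq[of "A j" "A i"] finite_subset by blast
    then show ?thesis using *(1) by blast
  qed
  then show ?thesis by blast
qed

text \<open>The second component breaks ties between subdivision vertices next to the same original vertex:
  at a common lower end the farther upper end comes first, at a common upper end the nearer lower
  end comes first. This separates half-edges at \<open>a < c\<close> that belong to overlapping edges with a
  common end.\<close>

definition side_key :: "nat \<Rightarrow> (nat set \<Rightarrow> bool) \<Rightarrow> nat + nat set \<Rightarrow> int \<times> int" where
  "side_key n R u = (case u of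
      Inl v \<Rightarrow> (int v, 0)
    | Inr e \<Rightarrow> if R e then (int (Max e), - 1 - int (Min e))
              else (int (Min e), 1 + int n - int (Max e)))"

text \<open>The negative second component puts subdivision vertices just before the original vertex
  at the pivot; at a common pivot the larger lower end comes first.\<close>

definition pivot_key :: "nat + nat set \<Rightarrow> int \<times> int" where
  "pivot_key u = (case u of
      Inl v \<Rightarrow> (int v, 0)
    | Inr e \<Rightarrow> (int (pivot (Min e) (Max e)), - 1 - int (Min e)))"

lemma side_key_simps:
  "side_key n R (Inl v) = (int v, 0)"
  "a < b \<Longrightarrow> side_key n R (Inr {a, b}) =
     (if R {a, b} then (int b, - 1 - int a) else (int a, 1 + int n - int b))"
  "a < b \<Longrightarrow> side_key n R (Inr {b, a}) =
     (if R {a, b} then (int b, - 1 - int a) else (int a, 1 + int n - int b))"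
  by (auto simp: side_key_def insert_commute)

lemma pivot_key_simps:
  "pivot_key (Inl v) = (int v, 0)"
  "a < b \<Longrightarrow> pivot_key (Inr {a, b}) = (int (pivot a b), - 1 - int a)"
  "a < b \<Longrightarrow> pivot_key (Inr {b, a}) = (int (pivot a b), - 1 - int a)"
  by (auto simp: pivot_key_def)

definition level_key :: "nat \<Rightarrow> (nat \<Rightarrow> nat set) \<Rightarrow> nat \<Rightarrow> nat + nat set \<Rightarrow> int \<times> int" where
  "level_key n A t = side_key n (\<lambda>e. t \<in> A (split_level (Min e) (Max e)))"

lemma keys_separate:
  assumes n: "n < 2 ^ q"
    and A: "\<forall>i<q. \<forall>j<q. i \<noteq> j \<longrightarrow> (\<exists>t<m. t \<in> A i \<and> t \<notin> A j)"
    and v: "{a, b, c, d} \<subseteq> {1..n}" and ne: "a \<noteq> b" "c \<noteq> d" "{a, b} \<noteq> {c, d}" and "a < c"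
  shows "\<exists>\<kappa>\<in>{side_key n (\<lambda>_. False), side_key n (\<lambda>_. True), pivot_key} \<union> level_key n A ` {..<m}.
           \<forall>u\<in>{Inl a, Inr {a, b}}. \<forall>v\<in>{Inl c, Inr {c, d}}. \<kappa> u < \<kappa> v"
    (is "\<exists>\<kappa>\<in>?K. ?sep \<kappa>")
proof -
  have lower: "?thesis" if "?sep (side_key n (\<lambda>_. False))" using that by blast
  have upper: "?thesis" if "?sep (side_key n (\<lambda>_. True))" using that by blast
  \<comment> \<open>Only the last case, \<open>d < a < c < b\<close>, is crossing. In the others a
    constant choice of side suffices, with a tie at the shared end in the sixth and seventh.\<close>
  consider "a < b" "c < d" | "b < a" "d < c" | "b < a" "c < d"
    | "a < b" "d < c" "a < d" | "a < b" "d < c" "b < c"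
    | "a < b" "d < c" "d = a" "c < b" | "a < b" "d < c" "d < a" "b = c" | "d < a" "c < b"
    using ne \<open>a < c\<close> by (auto simp: doubleton_eq_iff) linarith+
  then show ?thesis
  proof cases
    case 1
    show ?thesis by (rule lower) (use 1 v \<open>a < c\<close> in \<open>auto simp: side_key_simps\<close>)
  next
    case 2
    show ?thesis by (rule upper) (use 2 v \<open>a < c\<close> in \<open>auto simp: side_key_simps\<close>)
  next
    case 3
    show ?thesis by (rule lower) (use 3 v \<open>a < c\<close> in \<open>auto simp: side_key_simps\<close>)
  next
    case 4
    show ?thesis by (rule lower) (use 4 v \<open>a < c\<close> in \<open>auto simp: side_key_simps\<close>)
  next
    case 5
    show ?thesis by (rule upper) (use 5 v \<open>a < c\<close> in \<open>auto simp: side_key_simps\<close>)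
  next
    case 6
    show ?thesis by (rule lower) (use 6 v \<open>a < c\<close> in \<open>auto simp: side_key_simps\<close>)
  next
    case 7
    show ?thesis by (rule upper) (use 7 v \<open>a < c\<close> in \<open>auto simp: side_key_simps\<close>)
  next
    case 8
    then have lt: "a < b" "d < c" using \<open>a < c\<close> by auto
    show ?thesis
    proof (cases "split_level d c = split_level a b")
      case True
      \<comment> \<open>The common pivot \<open>p\<close> satisfies \<open>a < p \<le> c\<close>, so
        both subdivision vertices fall between \<open>a\<close> and \<open>c\<close>, that of
        \<open>{a, b}\<close> first since \<open>d < a\<close>.\<close>
      have "?sep pivot_key"
        using lt 8 \<open>a < c\<close> pivot_bounds[OF lt(1)] pivot_bounds[OF lt(2)]
          pivot_eq_if_crossing[OF 8(1) \<open>a < c\<close> 8(2) True]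
        by (auto simp: pivot_key_simps)
      then show ?thesis by blast
    next
      case False
      have "split_level d c < q" "split_level a b < q"
        using lt v n by (auto intro!: split_level(1))
      with False A obtain t where t: "t < m" "t \<in> A (split_level d c)" "t \<notin> A (split_level a b)"
        by blast
      \<comment> \<open>This \<open>t\<close> sends \<open>{c, d}\<close> to its upper end
        \<open>c\<close> and \<open>{a, b}\<close> to its lower end \<open>a\<close>.\<close>
      have "?sep (level_key n A t)"
        using t lt v \<open>a < c\<close> by (auto simp: level_key_def side_key_simps)
      then show ?thesis using t(1) by blast
    qed
  qed
qed

lemma separation_dimension_upper_bound:
  assumes n: "n < 2 ^ q" and q: "q \<le> (2 * s) choose s"
  shows "separation_dimension (subdivide (complete_graph n)) \<le> 2 * s + 3"
proof -
  obtain A where A: "\<forall>i<q. \<forall>j<q. i \<noteq> j \<longrightarrow> (\<exists>t<2 * s. t \<in> A i \<and> t \<notin> A j)"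
    using ex_antichain[OF q] by blast
  let ?K3 = "{side_key n (\<lambda>_. False), side_key n (\<lambda>_. True), pivot_key}"
  let ?K = "?K3 \<union> level_key n A ` {..<2 * s}"
  have "separation_dimension (subdivide (complete_graph n)) \<le> card ?K"
  proof (rule separation_dimension_le_card_keys)
    show "simple_graph (subdivide (complete_graph n))"
      by (intro simple_graph_subdivide simple_graph_complete_graph)
    fix e f assume "e \<in> edges (subdivide (complete_graph n))"
      "f \<in> edges (subdivide (complete_graph n))" "e \<inter> f = {}"
    then obtain a b c d where
      e: "e = {Inl a, Inr {a, b}}" "{a, b} \<subseteq> {1..n}" "a \<noteq> b" and
      f: "f = {Inl c, Inr {c, d}}" "{c, d} \<subseteq> {1..n}" "c \<noteq> d"
      unfolding edge_subdivide_complete_graph by blast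
    with \<open>e \<inter> f = {}\<close> have ef: "a \<noteq> c" "{a, b} \<noteq> {c, d}" by auto
    consider "a < c" | "c < a" using ef by linarith
    then show "\<exists>\<kappa>\<in>?K. (\<forall>u\<in>e. \<forall>v\<in>f. \<kappa> u < \<kappa> v) \<or> (\<forall>u\<in>e. \<forall>v\<in>f. \<kappa> v < \<kappa> u)"
    proof cases
      case 1
      have "\<exists>\<kappa>\<in>?K. \<forall>u\<in>e. \<forall>v\<in>f. \<kappa> u < \<kappa> v"
        unfolding e(1) f(1) by (rule keys_separate[OF n A]) (use e f ef 1 in auto)
      then show ?thesis by blast
    next
      case 2
      have "\<exists>\<kappa>\<in>?K. \<forall>v\<in>f. \<forall>u\<in>e. \<kappa> v < \<kappa> u"
        unfolding e(1) f(1) by (rule keys_separate[OF n A]) (use e f ef 2 in auto)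
      then show ?thesis by blast
    qed
  qed simp
  also have "\<dots> \<le> card ?K3 + card (level_key n A ` {..<2 * s})"
    by (rule card_Un_le)
  also have "\<dots> \<le> 3 + 2 * s"
    using card_image_le[of "{..<2 * s}" "level_key n A"]
    by (intro add_mono) (auto simp: card_insert_if)
  finally show ?thesis by simp
qed

section \<open>Choice of parameters and asymptotics\<close>

lemma separation_dimension_asymptotic_bound:
  "\<forall>\<^sub>F n in sequentially. real (separation_dimension (subdivide (complete_graph n)))
     \<le> log 2 (log 2 (real n - 1)) + 2 * log 2 (log 2 (log 2 (real n - 1))) + 5"
proof -
  let ?y = "\<lambda>n::nat. log 2 (log 2 (real n - 1))"
  have y: "filterlim ?y at_top sequentially" by real_asymp
  \<comment> \<open>The left side bounds \<open>q * (2 * s)\<close> from above, the right side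
    bounds \<open>4 ^ s\<close> from below, for the \<open>q\<close> and \<open>s\<close> chosen
    later.\<close>
  have "\<forall>\<^sub>F y::real in at_top. (2 powr y + 2) * (y + 2 * log 2 y + 2) \<le> 2 powr y * y ^ 2"
    by real_asymp
  moreover have "\<forall>\<^sub>F y::real in at_top. y \<ge> 2"
    by (rule eventually_ge_at_top)
  ultimately have "\<forall>\<^sub>F y::real in at_top. y \<ge> 2 \<and>
      (2 powr y + 2) * (y + 2 * log 2 y + 2) \<le> 2 powr y * y ^ 2"
    by (simp add: eventually_conj_iff)
  with y have "\<forall>\<^sub>F n in sequentially. ?y n \<ge> 2 \<and>
      (2 powr ?y n + 2) * (?y n + 2 * log 2 (?y n) + 2) \<le> 2 powr ?y n * ?y n ^ 2"
    by (rule eventually_compose_filterlim[rotated])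
  then show ?thesis
    using eventually_ge_at_top[of 4]
  proof eventually_elim
    case (elim n)
    define x y where "x = log 2 (real n - 1)" and "y = log 2 x"
    have "x > 0" using elim by (simp add: x_def)
    then have xy: "2 powr y = x" by (simp add: y_def)
    have y2: "y \<ge> 2" and ineq: "(x + 2) * (y + 2 * log 2 y + 2) \<le> x * y ^ 2"
      using elim by (auto simp: xy simp flip: x_def y_def)
    \<comment> \<open>The term \<open>2 * log 2 y\<close> gives \<open>4 ^ s\<close> a factor
      \<open>y ^ 2\<close>, which beats the denominator \<open>2 * s\<close> of the central binomial
      bound.\<close>
    define s where "s = nat \<lceil>(y + 2 * log 2 y) / 2\<rceil>"
    \<comment> \<open>The successor absorbs the step from \<open>n - 1\<close> to
      \<open>n\<close>.\<close>
    define q where "q = Suc (nat \<lceil>x\<rceil>)"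
    have ly: "log 2 y \<ge> 1" using y2 by (simp add: le_log_iff)
    have "real s = of_int \<lceil>(y + 2 * log 2 y) / 2\<rceil>"
      using ly y2 by (simp add: s_def)
    then have s: "2 * real s \<ge> y + 2 * log 2 y" "2 * real s \<le> y + 2 * log 2 y + 2"
      using ceiling_correct[of "(y + 2 * log 2 y) / 2"] by argo+
    have q: "real q \<le> x + 2"
      using \<open>x > 0\<close> by (simp add: q_def of_nat_nat) linarith
    have "real n - 1 = 2 powr x"
      using elim by (simp add: x_def)
    also have "\<dots> \<le> 2 powr real (nat \<lceil>x\<rceil>)"
      by (intro powr_mono real_nat_ceiling_ge) simp
    also have "\<dots> = 2 ^ nat \<lceil>x\<rceil>" by (simp add: powr_realpow)
    finally have "real n \<le> 2 ^ nat \<lceil>x\<rceil> + 1" by simp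
    moreover have "(2::real) ^ 1 \<le> 2 ^ nat \<lceil>x\<rceil>"
      using \<open>x > 0\<close> by (intro power_increasing) (auto simp: Suc_le_eq)
    ultimately have "real n < 2 ^ q" by (simp add: q_def)
    then have nq: "n < 2 ^ q"
      by (metis of_nat_less_iff of_nat_numeral of_nat_power)
    have "2 * log 2 y = log 2 (y ^ 2)"
      using y2 by (simp add: log_nat_power)
    then have "2 powr (2 * log 2 y) = y ^ 2"
      using y2 by simp
    then have "x * y ^ 2 = 2 powr (y + 2 * log 2 y)"
      by (simp add: powr_add xy)
    also have "\<dots> \<le> 2 powr (2 * real s)"
      using s by simp
    also have "\<dots> = 4 ^ s"
      by (simp add: powr_realpow flip: powr_powr)
    finally have "x * y ^ 2 \<le> 4 ^ s" .
    have "real q * (2 * real s) \<le> (x + 2) * (y + 2 * log 2 y + 2)"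
      using s q \<open>x > 0\<close> by (intro mult_mono) linarith+
    with ineq \<open>x * y ^ 2 \<le> 4 ^ s\<close> have "real q * (2 * real s) \<le> 4 ^ s" by linarith
    moreover have "s > 0" using s ly y2 by (intro gr0I) auto
    ultimately have "real q \<le> 4 ^ s / (2 * real s)"
      by (simp add: pos_le_divide_eq)
    also have "\<dots> \<le> real ((2 * s) choose s)"
      using \<open>s > 0\<close> by (rule central_binomial_lower_bound)
    finally have "real q \<le> real ((2 * s) choose s)" .
    then have "separation_dimension (subdivide (complete_graph n)) \<le> 2 * s + 3"
      by (intro separation_dimension_upper_bound[OF nq]) simp
    then have "real (separation_dimension (subdivide (complete_graph n))) \<le> 2 * real s + 3"
      by linarith
    \<comment> \<open>The 5 consists of three extra keys and at most 2 from rounding in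
      \<open>s\<close>.\<close>
    then show ?case using s(2) by (simp add: x_def y_def)
  qed
qed

theorem theorem2:
  "(\<forall>n::nat. n \<ge> 3 \<longrightarrow>
      1 / 2 * real_of_int \<lfloor>log 2 (log 2 (real n - 1))\<rfloor>
        \<le> real (separation_dimension (subdivide (complete_graph n)))) \<and>
   (\<exists>\<epsilon> :: nat \<Rightarrow> real. \<epsilon> \<longlonglongrightarrow> 0 \<and>
      (\<forall>n::nat. n \<ge> 4 \<longrightarrow>
        real (separation_dimension (subdivide (complete_graph n)))
          \<le> (1 + \<epsilon> n) * log 2 (log 2 (real n - 1))))"
proof (intro conjI allI impI exI)
  let ?y = "\<lambda>n::nat. log 2 (log 2 (real n - 1))"
  let ?\<pi> = "\<lambda>n. real (separation_dimension (subdivide (complete_graph n)))"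
  \<comment> \<open>The relative excess itself, cut off at 0 so that 0 bounds it from below.\<close>
  let ?\<epsilon> = "\<lambda>n. max 0 (?\<pi> n / ?y n - 1)"
  show "1 / 2 * real_of_int \<lfloor>?y n\<rfloor> \<le> ?\<pi> n" if "n \<ge> 3" for n
    using that by (rule separation_dimension_lower_bound)
  \<comment> \<open>At \<open>n = 3\<close> the iterated logarithm is 0; positivity starts at
    \<open>n = 4\<close>.\<close>
  have y_pos: "?y n > 0" if "n \<ge> 4" for n
    using that by (simp add: less_log_iff)
  show "?\<pi> n \<le> (1 + ?\<epsilon> n) * ?y n" if "n \<ge> 4" for n
    using y_pos[OF that] by (subst pos_divide_le_eq[symmetric]) auto
  show "?\<epsilon> \<longlonglongrightarrow> 0"
  proof (rule tendsto_sandwich[where f = "\<lambda>_. 0"])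
    show "(\<lambda>n::nat. (2 * log 2 (?y n) + 5) / ?y n) \<longlonglongrightarrow> 0" by real_asymp
    have "\<forall>\<^sub>F n in sequentially. 2 * log 2 (?y n) + 5 \<ge> 0" by real_asymp
    then show "\<forall>\<^sub>F n in sequentially. ?\<epsilon> n \<le> (2 * log 2 (?y n) + 5) / ?y n"
      using separation_dimension_asymptotic_bound eventually_ge_at_top[of 4]
    proof eventually_elim
      case (elim n)
      then have "(?\<pi> n - ?y n) / ?y n \<le> (2 * log 2 (?y n) + 5) / ?y n"
        using y_pos[of n] by (intro divide_right_mono) auto
      then show ?case using elim y_pos[OF elim(3)] by (simp add: diff_divide_distrib)
    qed
  qed auto
qed

end
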